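(* Let $I(x,y,z)$ be the exponential generating function in which the coefficient of $x^ry^d\frac{z^n}{n!}$ is the number of increasing binary trees of size $n$ whose $r$th leaf has depth $d$ (for $0\le r\le n$). Then $$I(x,y,z)=\left((1-z)(1-xz)\right)^{-y}.$$
   Context: A binary tree here means a complete binary tree: a rooted tree where each internal (non-leaf) node has a left child and a right child (the single-node tree is allowed). An increasing binary tree of size $n$ is a binary tree with $n$ internal nodes labeled with the distinct labels $1,2,\dots,n$ in such a way that labels increase when moving away from the root (leaves are unlabeled). Its $n+1$ leaves are indexed $0,1,\dots,n$ from left to right. The depth of a leaf is the number of edges in the path from the root to it. The power $(\cdot)^{-y}$ is understood as a formal power series in $z$ with coefficients polynomial in $x,y$. *)

theory Defs
  imports "HOL-Library.Tree" "HOL-Computational_Algebra.Computational_Algebra"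
begin

text \<open>
  Complete binary trees are rendered by the library's \<open>tree\<close>: internal nodes are the
  \<open>Node\<close>s, leaves are the \<open>Leaf\<close>s, and \<open>size\<close> counts internal nodes.
  The library's \<^const>\<open>heap\<close> only asks labels to increase weakly away from the root; with
  distinct labels the increase is strict.
\<close>

definition increasing_trees :: "nat \<Rightarrow> nat tree set" where
  "increasing_trees n =
     {t. size t = n \<and> distinct (inorder t) \<and> set_tree t = {1..n} \<and> heap t}"

text \<open>The depths of all leaves, listed from left to right.\<close>

fun leaf_depths :: "'a tree \<Rightarrow> nat list" where
  "leaf_depths Leaf = [0]"
| "leaf_depths (Node l a r) = map Suc (leaf_depths l @ leaf_depths r)"

definition leaf_depth_count :: "nat \<Rightarrow> nat \<Rightarrow> nat \<Rightarrow> nat" where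
  "leaf_depth_count n r d = card {t \<in> increasing_trees n. leaf_depths t ! r = d}"

text \<open>
  The ring \<open>\<rat>[x][y][[z]]\<close> is the type \<^typ>\<open>rat poly poly fps\<close>:
  the inner polynomial variable is \<open>x\<close>, the outer one \<open>y\<close>, and \<open>z\<close> is \<^const>\<open>fps_X\<close>.
\<close>

definition xvar :: "rat poly poly" where
  "xvar = [:[:0, 1:]:]"

definition yvar :: "rat poly poly" where
  "yvar = [:0, 1:]"

text \<open>
  A leaf of a tree with \<open>n\<close> internal nodes has depth at most \<open>n\<close>, so the inner sum
  captures all depths; see \<open>coeff_tree_egf\<close> below.
\<close>

definition tree_egf :: "rat poly poly fps" where
  "tree_egf = Abs_fps (\<lambda>n. \<Sum>r\<le>n. \<Sum>d\<le>n.
     [:[:of_nat (leaf_depth_count n r d) / fact n:]:] * xvar ^ r * yvar ^ d)"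

text \<open>
  The binomial series \<open>f\<^sup>a = (\<Sum>k. (a choose k) (f - 1)\<^sup>k)\<close>, meaningful for \<open>f\<close> with constant
  coefficient \<open>1\<close>, where \<open>a choose k = a (a - 1) \<dots> (a - k + 1) / k!\<close>. The library's
  \<^const>\<open>fps_binomial\<close> and \<^const>\<open>gbinomial\<close> are only usable over a field.
\<close>

definition fps_gpow :: "rat poly poly fps \<Rightarrow> rat poly poly \<Rightarrow> rat poly poly fps" where
  "fps_gpow f a =
     fps_compose (Abs_fps (\<lambda>k. [:[:1 / fact k:]:] * (\<Prod>i<k. a - of_nat i))) (f - 1)"

lemma length_leaf_depths: "length (leaf_depths t) = Suc (size t)"
  by (induction t) auto

lemma leaf_depths_le_size: "d \<in> set (leaf_depths t) \<Longrightarrow> d \<le> size t"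
  by (induction t arbitrary: d) force+

lemma finite_increasing_trees: "finite (increasing_trees n)"
proof -
  have fin: "finite {t :: nat tree. size t \<le> m \<and> set_tree t \<subseteq> {1..n}}" for m
  proof (induction m)
    case 0
    have "{t :: nat tree. size t \<le> 0 \<and> set_tree t \<subseteq> {1..n}} \<subseteq> {Leaf}" by auto
    then show ?case by (rule finite_subset) simp
  next
    case (Suc m)
    let ?T = "{t :: nat tree. size t \<le> m \<and> set_tree t \<subseteq> {1..n}}"
    let ?U = "{t :: nat tree. size t \<le> Suc m \<and> set_tree t \<subseteq> {1..n}}"
    have "?U \<subseteq> insert Leaf ((\<lambda>(l, a, r). Node l a r) ` (?T \<times> {1..n} \<times> ?T))"
    proof
      fix t assume "t \<in> ?U"
      then show "t \<in> insert Leaf ((\<lambda>(l, a, r). Node l a r) ` (?T \<times> {1..n} \<times> ?T))"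
        by (cases t) (auto simp: image_iff)
    qed
    then show ?case
      by (rule finite_subset) (intro finite.insertI finite_imageI finite_cartesian_product Suc
          finite_atLeastAtMost)
  qed
  show ?thesis
    by (rule finite_subset[OF _ fin[of n]]) (auto simp: increasing_trees_def)
qed

lemma leaf_depth_count_eq_0:
  assumes "r \<le> n" "n < d"
  shows "leaf_depth_count n r d = 0"
proof -
  have "{t \<in> increasing_trees n. leaf_depths t ! r = d} = {}"
  proof (rule ccontr)
    assume "\<not> ?thesis"
    then obtain t where "t \<in> increasing_trees n" and d: "leaf_depths t ! r = d"
      by blast
    then have n: "size t = n" by (simp add: increasing_trees_def)
    then have "d \<in> set (leaf_depths t)"
      using assms(1) d n by (metis length_leaf_depths less_Suc_eq_le nth_mem)
    then show False using leaf_depths_le_size n assms(2) by fastforce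
  qed
  then show ?thesis by (simp only: leaf_depth_count_def card.empty)
qed

lemma monomial_xy:
  "[:[:c:]:] * xvar ^ r * yvar ^ d = monom (monom c r) d"
proof -
  have x: "xvar ^ r = [:monom 1 r:]"
    by (induction r) (simp_all add: xvar_def one_pCons monom_Suc)
  have y: "yvar ^ d = monom 1 d"
    by (induction d) (simp_all add: yvar_def monom_Suc)
  show ?thesis by (simp add: x y smult_monom)
qed

lemma coeff_tree_egf:
  "coeff (coeff (fps_nth tree_egf n) d) r =
     (if r \<le> n then of_nat (leaf_depth_count n r d) / fact n else 0)"
proof -
  have "coeff (coeff (fps_nth tree_egf n) d) r =
    (\<Sum>r'\<le>n. \<Sum>d'\<le>n. coeff (coeff
       (monom (monom (of_nat (leaf_depth_count n r' d') / fact n) r') d') d) r)"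
    unfolding tree_egf_def monomial_xy fps_nth_Abs_fps coeff_sum ..
  also have "\<dots> = (\<Sum>r'\<le>n. \<Sum>d'\<le>n. if d' = d then
       (if r' = r then of_nat (leaf_depth_count n r d) / fact n else 0) else 0)"
    by (intro sum.cong refl) auto
  also have "\<dots> = (if r \<le> n then of_nat (leaf_depth_count n r d) / fact n else 0)"
    using leaf_depth_count_eq_0[of r n d] by (cases "d \<le> n") auto
  finally show ?thesis .
qed

end

theory Submission
  imports Defs
begin

text \<open>
  In an increasing tree with labels \<open>1, \<dots>, n + 1\<close> the node labelled \<open>n + 1\<close> has two leaf children, so
  every such tree arises exactly once from a tree of size \<open>n\<close> by replacing one of its \<open>n + 1\<close> leaves
  with a new node (\<open>bij_betw_graft\<close>). Follow the \<open>r\<close>th leaf of the larger tree back: it is an old leaf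
  \<open>r\<close> with the replaced leaf to its right (\<open>n - r\<close> choices), an old leaf \<open>r - 1\<close> with the replaced leaf
  to its left (\<open>r - 1\<close> choices), or one of the two children of the new node, one level below the old
  leaf \<open>r\<close> or \<open>r - 1\<close>. With \<open>Q\<^sub>n\<^sub>,\<^sub>r(y)\<close> the sum of \<open>y\<close> to the depth of the \<open>r\<close>th leaf over all increasing
  trees of size \<open>n\<close>, this says
  \<open>Q\<^sub>n\<^sub>+\<^sub>1\<^sub>,\<^sub>r = (y + n - r) Q\<^sub>n\<^sub>,\<^sub>r + (y + r - 1) Q\<^sub>n\<^sub>,\<^sub>r\<^sub>-\<^sub>1\<close>,
  a weighted Pascal recurrence that the product of \<open>n choose r\<close> and the rising factorials of \<open>y\<close> of
  lengths \<open>r\<close> and \<open>n - r\<close> solves (\<open>depth_poly_eq\<close>).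

  The closed form makes the generating function a product of two series \<open>\<Sum>n. y(y+1)\<dots>(y+n-1) c\<^sup>n z\<^sup>n / n!\<close>
  with \<open>c = x\<close> and \<open>c = 1\<close>. Each is \<open>(1 - cz)\<close> to the power \<open>-y\<close>, but instead of developing the laws of
  exponents for powers with a polynomial exponent, both sides of the theorem are shown to solve
  \<open>f F' = -y f' F\<close> with \<open>f = (1 - z)(1 - xz)\<close> and \<open>F(0) = 1\<close>. This linear equation determines the
  coefficients of \<open>F\<close> one after the other (\<open>fps_linear_ode_unique\<close>).
\<close>

section \<open>Growing a tree at a leaf\<close>

fun graft :: "'a \<Rightarrow> nat \<Rightarrow> 'a tree \<Rightarrow> 'a tree" where
  "graft a k Leaf = Node Leaf a Leaf"
| "graft a k (Node l b r) =
     (if k \<le> size l then Node (graft a k l) b r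
      else Node l b (graft a (k - Suc (size l)) r))"

text \<open>
  The left inverse of grafting a label that does not occur in the tree.
\<close>

fun prune :: "'a \<Rightarrow> 'a tree \<Rightarrow> 'a tree" where
  "prune a Leaf = Leaf"
| "prune a (Node l b r) = (if b = a then Leaf else Node (prune a l) b (prune a r))"

text \<open>
  Position \<open>k\<close> of the inorder listing is the gap occupied by leaf \<open>k\<close>. This both transfers distinctness
  of labels and lets the chosen leaf be read off from the larger tree.
\<close>

lemma inorder_graft:
  "k \<le> size t \<Longrightarrow> inorder (graft a k t) = take k (inorder t) @ a # drop k (inorder t)"
proof (induction t arbitrary: k)
  case Leaf
  then show ?case by simp
next
  case (Node l b r)
  show ?case
  proof (cases "k \<le> size l")
    case True
    then show ?thesis using Node.IH(1)[OF True] by simp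
  next
    case False
    then obtain i where i: "k = Suc (size l) + i"
      by (metis le_Suc_ex not_less_eq_eq)
    then have "i \<le> size r" using Node.prems by simp
    then show ?thesis using Node.IH(2)[of i] by (simp add: i)
  qed
qed

lemma size_graft: "size (graft a k t) = Suc (size t)"
  by (induction t arbitrary: k) auto

lemma set_tree_graft: "set_tree (graft a k t) = insert a (set_tree t)"
  by (induction t arbitrary: k) auto

lemma distinct_graft:
  assumes "k \<le> size t" "a \<notin> set_tree t" "distinct (inorder t)"
  shows "distinct (inorder (graft a k t))"
proof -
  have "distinct (a # take k (inorder t) @ drop k (inorder t))"
    using assms by simp
  then show ?thesis
    unfolding inorder_graft[OF assms(1)] by (simp only: distinct.simps distinct_append set_append) auto
qed

lemma distinct_graftD:
  assumes "k \<le> size t" "distinct (inorder (graft a k t))"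
  shows "distinct (inorder t)"
proof -
  have "distinct (take k (inorder t) @ drop k (inorder t))"
    using assms(2) unfolding inorder_graft[OF assms(1)]
    by (simp only: distinct.simps distinct_append) auto
  then show ?thesis by simp
qed

lemma heap_graft:
  "heap t \<Longrightarrow> \<forall>x\<in>set_tree t. x \<le> a \<Longrightarrow> heap (graft a k t)"
  by (induction t arbitrary: k) (auto simp: set_tree_graft)

lemma prune_id: "a \<notin> set_tree t \<Longrightarrow> prune a t = t"
  by (induction t) auto

lemma prune_graft: "a \<notin> set_tree t \<Longrightarrow> prune a (graft a k t) = t"
  by (induction t arbitrary: k) (auto simp: prune_id)

text \<open>
  Pruning recovers the tree, and the position of the fresh label in the inorder listing recovers the leaf.
\<close>

lemma graft_inj:
  assumes "graft a j s = graft a k t" "j \<le> size s" "k \<le> size t"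
    "a \<notin> set_tree s" "a \<notin> set_tree t"
  shows "s = t \<and> j = k"
proof
  show "s = t" using assms by (metis prune_graft)
  have "length (takeWhile (\<lambda>x. x \<noteq> a) (inorder (graft a i u))) = i"
    if "i \<le> size u" "a \<notin> set_tree u" for i u
  proof -
    have "\<forall>x\<in>set (take i (inorder u)). x \<noteq> a"
      using that(2) by (auto dest: in_set_takeD)
    then have "takeWhile (\<lambda>x. x \<noteq> a) (inorder (graft a i u)) = take i (inorder u)"
      by (simp add: inorder_graft[OF that(1)] takeWhile_append2)
    then show ?thesis using that by simp
  qed
  then show "j = k" using assms by metis
qed

text \<open>
  A node with the maximal label cannot have labelled nodes below it, since their labels would have to be
  equal to its own, against distinctness; so it is a grafted one.
\<close>

lemma heap_eq_graft:
  assumes "heap t" "distinct (inorder t)" "a \<in> set_tree t" "\<forall>x\<in>set_tree t. x \<le> a"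
  shows "\<exists>s k. t = graft a k s \<and> k \<le> size s \<and> a \<notin> set_tree s \<and> heap s"
  using assms
proof (induction t)
  case Leaf
  then show ?case by simp
next
  case (Node l b r)
  consider "a = b" | "a \<in> set_tree l" "a \<noteq> b" "a \<notin> set_tree r"
    | "a \<in> set_tree r" "a \<noteq> b" "a \<notin> set_tree l"
    using Node.prems by auto
  then show ?case
  proof cases
    case 1
    have "set_tree l \<subseteq> {b}" "set_tree r \<subseteq> {b}"
      using Node.prems 1 by force+
    moreover have "b \<notin> set_tree l" "b \<notin> set_tree r"
      using Node.prems(2) by auto
    ultimately have "set_tree l = {}" "set_tree r = {}" by blast+
    then have "l = Leaf" "r = Leaf" by simp_all
    then show ?thesis
      using 1 by (intro exI[of _ Leaf] exI[of _ 0]) simp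
  next
    case 2
    obtain s k where s: "l = graft a k s" "k \<le> size s" "a \<notin> set_tree s" "heap s"
      using Node.IH(1) Node.prems 2 by auto
    have "Node l b r = graft a k (Node s b r)" using s by simp
    moreover have "heap (Node s b r)" using Node.prems s by (auto simp: set_tree_graft)
    ultimately show ?thesis using s 2
      by (intro exI[of _ "Node s b r"] exI[of _ k]) auto
  next
    case 3
    obtain s k where s: "r = graft a k s" "k \<le> size s" "a \<notin> set_tree s" "heap s"
      using Node.IH(2) Node.prems 3 by auto
    have "Node l b r = graft a (k + Suc (size l)) (Node l b s)" using s by simp
    moreover have "heap (Node l b s)" using Node.prems s by (auto simp: set_tree_graft)
    ultimately show ?thesis using s 3
      by (intro exI[of _ "Node l b s"] exI[of _ "k + Suc (size l)"]) auto
  qed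
qed

lemma bij_betw_graft:
  "bij_betw (\<lambda>(t, k). graft (Suc n) k t) (increasing_trees n \<times> {..n}) (increasing_trees (Suc n))"
proof (rule bij_betw_imageI)
  show "inj_on (\<lambda>(t, k). graft (Suc n) k t) (increasing_trees n \<times> {..n})"
  proof (rule inj_onI, clarify)
    fix s j t k
    assume "s \<in> increasing_trees n" "t \<in> increasing_trees n" "j \<le> n" "k \<le> n"
      "graft (Suc n) j s = graft (Suc n) k t"
    then show "s = t \<and> j = k"
      by (intro graft_inj[of "Suc n"]) (auto simp: increasing_trees_def)
  qed
  show "(\<lambda>(t, k). graft (Suc n) k t) ` (increasing_trees n \<times> {..n}) = increasing_trees (Suc n)"
  proof (intro equalityI subsetI)
    fix t assume "t \<in> (\<lambda>(t, k). graft (Suc n) k t) ` (increasing_trees n \<times> {..n})"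
    then show "t \<in> increasing_trees (Suc n)"
      by (auto simp: increasing_trees_def size_graft set_tree_graft intro!: distinct_graft heap_graft)
  next
    fix t assume t: "t \<in> increasing_trees (Suc n)"
    have "heap t" "distinct (inorder t)" and set_t: "set_tree t = {1..Suc n}"
      using t by (simp_all add: increasing_trees_def)
    moreover have "Suc n \<in> set_tree t" "\<forall>x\<in>set_tree t. x \<le> Suc n"
      unfolding set_t by simp_all
    ultimately obtain s k where
      s: "t = graft (Suc n) k s" "k \<le> size s" "Suc n \<notin> set_tree s" "heap s"
      using heap_eq_graft by blast
    have "insert (Suc n) (set_tree s) = {1..Suc n}"
      using set_t unfolding s(1) set_tree_graft .
    then have "set_tree s = {1..Suc n} - {Suc n}"
      using s(3) by blast
    also have "\<dots> = {1..n}" by auto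
    finally have "set_tree s = {1..n}" .
    moreover have "size s = n"
      using t s(1) by (simp add: increasing_trees_def size_graft)
    moreover have "distinct (inorder s)"
      using distinct_graftD[OF s(2)] \<open>distinct (inorder t)\<close> s(1) by blast
    ultimately have "s \<in> increasing_trees n"
      using s(4) by (simp add: increasing_trees_def)
    then show "t \<in> (\<lambda>(t, k). graft (Suc n) k t) ` (increasing_trees n \<times> {..n})"
      using s by (intro image_eqI[of _ _ "(s, k)"]) (auto simp: increasing_trees_def)
  qed
qed

section \<open>The distribution of the depth of a given leaf\<close>

text \<open>
  Grafting turns leaf \<open>k\<close> into the leaves \<open>k\<close> and \<open>k + 1\<close>, one level deeper, and shifts the leaves to
  its right by one position.
\<close>

lemma nth_leaf_depths_graft:
  assumes "k \<le> size t" "r \<le> Suc (size t)"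
  shows "leaf_depths (graft a k t) ! r =
    (if r < k then leaf_depths t ! r
     else if r = k then Suc (leaf_depths t ! r)
     else if r = Suc k then Suc (leaf_depths t ! (r - 1))
     else leaf_depths t ! (r - 1))"
  using assms
proof (induction t arbitrary: k r)
  case Leaf
  then show ?case by (auto simp: nth_Cons' less_Suc_eq)
next
  case (Node u b v)
  show ?case
  proof (cases "k \<le> size u")
    case True
    show ?thesis
    proof (cases "r \<le> Suc (size u)")
      case r: True
      then show ?thesis using True Node.IH(1)[OF True r] Node.prems
        by (auto simp: nth_append length_leaf_depths size_graft)
    next
      case False
      then show ?thesis using True Node.prems
        by (auto simp: nth_append length_leaf_depths size_graft)
    qed
  next
    case False
    show ?thesis
    proof (cases "r \<le> size u")
      case True
      then show ?thesis using False Node.prems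
        by (auto simp: nth_append length_leaf_depths size_graft)
    next
      case r: False
      obtain i where i: "k = Suc (size u) + i"
        using False by (metis le_Suc_ex not_less_eq_eq)
      obtain j where j: "r = Suc (size u) + j"
        using r by (metis le_Suc_ex not_less_eq_eq)
      \<comment> \<open>Whether leaf \<open>r - 1\<close> lies in \<open>v\<close> depends on \<open>j\<close> being positive.\<close>
      have "i \<le> size v" "j \<le> Suc (size v)" using Node.prems i j by auto
      then show ?thesis using Node.IH(2)[of i j]
        by (cases j) (auto simp: i j nth_append length_leaf_depths size_graft)
    qed
  qed
qed

definition depth_poly :: "'a::comm_ring_1 \<Rightarrow> nat \<Rightarrow> nat \<Rightarrow> 'a" where
  "depth_poly y n r = (\<Sum>t\<in>increasing_trees n. y ^ (leaf_depths t ! r))"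

text \<open>
  The two summands collect the grafting positions for which the new leaf \<open>r\<close> stems from the old leaf \<open>r\<close>
  and from the old leaf \<open>r - 1\<close>. The contribution \<open>y\<close> in each comes from grafting at that very leaf.
\<close>

lemma sum_pow_depth_graft:
  fixes y :: "'a::comm_ring_1"
  assumes "size t = n" "r \<le> Suc n"
  shows "(\<Sum>k\<le>n. y ^ (leaf_depths (graft a k t) ! r)) =
    (if r \<le> n then (y + of_nat (n - r)) * y ^ (leaf_depths t ! r) else 0) +
    (if 0 < r then (y + of_nat (r - 1)) * y ^ (leaf_depths t ! (r - 1)) else 0)"
proof -
  define A where "A = y ^ (leaf_depths t ! r)"
  define B where "B = y ^ (leaf_depths t ! (r - 1))"
  \<comment> \<open>The test \<open>0 < r\<close> is separate because \<open>k = r - 1\<close> would also hold for \<open>k = r = 0\<close>.\<close>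
  have "(\<Sum>k\<le>n. y ^ (leaf_depths (graft a k t) ! r)) =
    (\<Sum>k\<le>n. (if k = r then y * A else 0) + (if k \<in> {r<..} then A else 0)
       + ((if k = r - 1 then if 0 < r then y * B else 0 else 0) + (if k \<in> {..<r - 1} then B else 0)))"
    using assms by (intro sum.cong refl) (auto simp: nth_leaf_depths_graft A_def B_def)
  also have "\<dots> = (if r \<le> n then y * A else 0) + of_nat (card ({..n} \<inter> {r<..})) * A
      + ((if 0 < r then y * B else 0) + of_nat (card ({..n} \<inter> {..<r - 1})) * B)"
    using assms(2) by (simp only: sum.distrib sum.delta sum.inter_restrict[symmetric] finite_atMost sum_constant) auto
  also have "{..n} \<inter> {r<..} = {r<..n}" by auto
  also have "{..n} \<inter> {..<r - 1} = {..<r - 1}" using assms(2) by auto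
  finally show ?thesis
    by (auto simp: A_def B_def algebra_simps)
qed

lemma depth_poly_Suc:
  assumes "r \<le> Suc n"
  shows "depth_poly y (Suc n) r =
    (if r \<le> n then (y + of_nat (n - r)) * depth_poly y n r else 0) +
    (if 0 < r then (y + of_nat (r - 1)) * depth_poly y n (r - 1) else 0)"
proof -
  have "depth_poly y (Suc n) r =
      (\<Sum>(t, k)\<in>increasing_trees n \<times> {..n}. y ^ (leaf_depths (graft (Suc n) k t) ! r))"
    unfolding depth_poly_def sum.reindex_bij_betw[OF bij_betw_graft, symmetric]
    by (simp add: case_prod_unfold)
  also have "\<dots> = (\<Sum>t\<in>increasing_trees n. \<Sum>k\<le>n. y ^ (leaf_depths (graft (Suc n) k t) ! r))"
    by (rule sum.cartesian_product[symmetric])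
  also have "\<dots> = (\<Sum>t\<in>increasing_trees n.
      (if r \<le> n then (y + of_nat (n - r)) * y ^ (leaf_depths t ! r) else 0) +
      (if 0 < r then (y + of_nat (r - 1)) * y ^ (leaf_depths t ! (r - 1)) else 0))"
    using assms by (intro sum.cong refl sum_pow_depth_graft) (auto simp: increasing_trees_def)
  finally show ?thesis
    by (auto simp: depth_poly_def sum.distrib sum_distrib_left)
qed

lemma increasing_trees_0: "increasing_trees 0 = {Leaf}"
  by (auto simp: increasing_trees_def)

text \<open>
  Raising either rising factorial by one step produces exactly the weight of the corresponding summand in
  \<open>depth_poly_Suc\<close>, so what remains of the recurrence is Pascal's rule.
\<close>

theorem depth_poly_eq:
  "r \<le> n \<Longrightarrow> depth_poly y n r = of_nat (n choose r) * pochhammer y r * pochhammer y (n - r)"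
proof (induction n arbitrary: r)
  case 0
  then show ?case by (simp add: depth_poly_def increasing_trees_0)
next
  case (Suc n)
  show ?case
  proof (cases r)
    case 0
    then show ?thesis using Suc.IH[of 0]
      by (simp add: depth_poly_Suc pochhammer_Suc algebra_simps)
  next
    case (Suc q)
    have q: "q \<le> n" using Suc Suc.prems by simp
    show ?thesis
    proof (cases "r \<le> n")
      case True
      then obtain m where m: "n = Suc q + m" using Suc le_Suc_ex by blast
      have "depth_poly y (Suc n) r =
          (y + of_nat m) * (of_nat (n choose Suc q) * (pochhammer y q * (y + of_nat q)) * pochhammer y m)
          + (y + of_nat q) * (of_nat (n choose q) * pochhammer y q * (pochhammer y m * (y + of_nat m)))"
        using Suc.IH[OF True] Suc.IH[OF q] True Suc m
        by (simp add: depth_poly_Suc pochhammer_Suc)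
      also have "\<dots> = of_nat ((n choose q) + (n choose Suc q))
          * (pochhammer y q * (y + of_nat q)) * (pochhammer y m * (y + of_nat m))"
        by (simp only: of_nat_add) (simp add: algebra_simps)
      finally show ?thesis using Suc m by (simp add: pochhammer_Suc)
    next
      case False
      then have "q = n" "r = Suc n" using Suc Suc.prems by simp_all
      then show ?thesis using Suc.IH[OF q]
        by (simp add: depth_poly_Suc pochhammer_Suc algebra_simps)
    qed
  qed
qed

section \<open>The generating function as a product\<close>

abbreviation cst :: "rat \<Rightarrow> rat poly poly" where "cst q \<equiv> [:[:q:]:]"

lemma cst_mult: "cst p * cst q = cst (p * q)"
  by simp

text \<open>
  Rewriting natural numbers into the coefficient field turns identities between scalars into identities of
  rational numbers.
\<close>

lemma of_nat_eq_cst: "of_nat n = cst (of_nat n)"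
  by (simp add: of_nat_poly)

lemma sum_leaf_depth_count:
  assumes "r \<le> n"
  shows "(\<Sum>d\<le>n. of_nat (leaf_depth_count n r d) * y ^ d) = depth_poly y n r"
proof -
  have "(\<Sum>d\<le>n. of_nat (leaf_depth_count n r d) * y ^ d)
    = (\<Sum>d\<le>n. \<Sum>t\<in>{t \<in> increasing_trees n. leaf_depths t ! r = d}. y ^ (leaf_depths t ! r))"
    by (intro sum.cong refl) (simp add: leaf_depth_count_def)
  also have "\<dots> = depth_poly y n r"
    unfolding depth_poly_def
  proof (intro sum.group finite_increasing_trees finite_atMost, clarify)
    fix t assume "t \<in> increasing_trees n"
    then have "size t = n" by (simp add: increasing_trees_def)
    then show "leaf_depths t ! r \<le> n"
      using leaf_depths_le_size[of "leaf_depths t ! r" t] assms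
      by (simp add: length_leaf_depths)
  qed
  finally show ?thesis .
qed

text \<open>This is the binomial series \<open>(1 - c z)\<close> to the power \<open>-y\<close>.\<close>

definition rising_series :: "rat poly poly \<Rightarrow> rat poly poly fps" where
  "rising_series c = Abs_fps (\<lambda>n. cst (1 / fact n) * pochhammer yvar n * c ^ n)"

text \<open>
  Since \<open>(n choose r) / n! = 1 / (r! (n - r)!)\<close>, the closed form of \<open>depth_poly\<close> is the summand of a
  Cauchy product.
\<close>

lemma tree_egf_eq_prod: "tree_egf = rising_series xvar * rising_series 1"
proof (rule fps_ext)
  fix n
  have "fps_nth tree_egf n =
      (\<Sum>r\<le>n. cst (1 / fact n) * xvar ^ r * (\<Sum>d\<le>n. of_nat (leaf_depth_count n r d) * yvar ^ d))"
    unfolding tree_egf_def fps_nth_Abs_fps sum_distrib_left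
    by (intro sum.cong refl) (simp add: of_nat_eq_cst mult_ac)
  also have "\<dots> = (\<Sum>r\<le>n. cst (1 / fact n) * xvar ^ r * depth_poly yvar n r)"
    by (intro sum.cong refl) (simp add: sum_leaf_depth_count)
  also have "\<dots> = (\<Sum>r\<le>n. fps_nth (rising_series xvar) r * fps_nth (rising_series 1) (n - r))"
  proof (intro sum.cong refl)
    fix r assume "r \<in> {..n}"
    then have r: "r \<le> n" by simp
    have "cst (1 / fact n) * of_nat (n choose r) = cst (1 / fact r) * cst (1 / fact (n - r))"
      unfolding of_nat_eq_cst cst_mult using r by (simp add: binomial_fact)
    then show "cst (1 / fact n) * xvar ^ r * depth_poly yvar n r =
        fps_nth (rising_series xvar) r * fps_nth (rising_series 1) (n - r)"
      unfolding depth_poly_eq[OF r] rising_series_def fps_nth_Abs_fps power_one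
      by (metis (no_types, lifting) mult.commute mult.left_commute mult_1)
  qed
  finally show "fps_nth tree_egf n = fps_nth (rising_series xvar * rising_series 1) n"
    by (simp add: fps_mult_nth atMost_atLeast0)
qed

lemma cst_inverse_fact_Suc: "of_nat (Suc n) * cst (1 / fact (Suc n)) = cst (1 / fact n)"
  unfolding of_nat_eq_cst cst_mult by (simp add: field_simps del: of_nat_Suc)

section \<open>Comparison through a differential equation\<close>

lemma fps_deriv_rising_series:
  "(1 - fps_const c * fps_X) * fps_deriv (rising_series c) = fps_const (c * yvar) * rising_series c"
proof (rule fps_ext)
  have rec: "of_nat (Suc n) * fps_nth (rising_series c) (Suc n)
      = c * (yvar + of_nat n) * fps_nth (rising_series c) n" for n
    unfolding rising_series_def fps_nth_Abs_fps pochhammer_Suc power_Suc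
    using cst_inverse_fact_Suc[of n]
    by (metis (no_types, lifting) mult.commute mult.left_commute)
  fix n
  show "fps_nth ((1 - fps_const c * fps_X) * fps_deriv (rising_series c)) n
      = fps_nth (fps_const (c * yvar) * rising_series c) n"
  proof (cases n)
    case 0
    then show ?thesis using rec[of 0] by (simp add: algebra_simps)
  next
    case (Suc m)
    have "fps_nth ((1 - fps_const c * fps_X) * fps_deriv (rising_series c)) n =
        of_nat (Suc n) * fps_nth (rising_series c) (Suc n)
        - c * (of_nat n * fps_nth (rising_series c) n)"
      using Suc by (simp add: left_diff_distrib mult.assoc del: of_nat_Suc)
    also have "\<dots> = c * yvar * fps_nth (rising_series c) n"
      unfolding rec by (simp add: distrib_left distrib_right mult.assoc)
    finally show ?thesis by simp
  qed
qed

text \<open>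
  If the difference \<open>D\<close> of two solutions vanishes up to degree \<open>m\<close>, then comparing coefficients of
  degree \<open>m\<close> in \<open>f D' = g D\<close> leaves \<open>(m + 1) D\<^sub>m\<^sub>+\<^sub>1 = 0\<close>; characteristic zero gives \<open>D\<^sub>m\<^sub>+\<^sub>1 = 0\<close>.
\<close>

lemma fps_linear_ode_unique:
  fixes F G :: "'a::{idom,ring_char_0} fps"
  assumes f: "fps_nth f 0 = 1"
    and F: "f * fps_deriv F = g * F" and G: "f * fps_deriv G = g * G"
    and init: "fps_nth F 0 = fps_nth G 0"
  shows "F = G"
proof -
  define D where "D = F - G"
  have D: "f * fps_deriv D = g * D"
    unfolding D_def using F G by (simp add: right_diff_distrib)
  have "fps_nth D n = 0" for n
  proof (induction n rule: less_induct)
    case (less n)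
    show ?case
    proof (cases n)
      case 0
      then show ?thesis using init by (simp add: D_def)
    next
      case (Suc m)
      have "fps_nth (f * fps_deriv D) m = (\<Sum>i=0..m. if i = 0 then of_nat (Suc m) * fps_nth D (Suc m) else 0)"
        unfolding fps_mult_nth using less Suc by (intro sum.cong refl) (auto simp: f)
      moreover have "fps_nth (g * D) m = 0"
        unfolding fps_mult_nth using less Suc by (intro sum.neutral) auto
      ultimately show ?thesis using D Suc by (simp del: of_nat_Suc)
    qed
  qed
  then have "D = 0" by (intro fps_ext) simp
  then show ?thesis by (simp add: D_def)
qed

text \<open>
  The logarithmic derivative of a power: the binomial series \<open>B\<close> satisfies \<open>(1 + z) B' = a B\<close>, and
  substituting \<open>f - 1\<close> for \<open>z\<close> turns this into the claim by the chain rule.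
\<close>

lemma fps_deriv_gpow:
  assumes "fps_nth f 0 = 1"
  shows "f * fps_deriv (fps_gpow f a) = fps_const a * fps_deriv f * fps_gpow f a"
proof -
  define B where "B = Abs_fps (\<lambda>k. cst (1 / fact k) * (\<Prod>i<k. a - of_nat i))"
  have gpow: "fps_gpow f a = fps_compose B (f - 1)"
    by (simp add: fps_gpow_def B_def)
  have f0: "fps_nth (f - 1) 0 = 0" using assms by simp
  have rec: "of_nat (Suc n) * fps_nth B (Suc n) = (a - of_nat n) * fps_nth B n" for n
    unfolding B_def fps_nth_Abs_fps prod.lessThan_Suc
    using cst_inverse_fact_Suc[of n]
    by (metis (no_types, lifting) mult.commute mult.left_commute)
  have ode: "(1 + fps_X) * fps_deriv B = fps_const a * B"
  proof (rule fps_ext)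
    fix n
    show "fps_nth ((1 + fps_X) * fps_deriv B) n = fps_nth (fps_const a * B) n"
    proof (cases n)
      case 0
      then show ?thesis using rec[of 0] by (simp add: algebra_simps)
    next
      case (Suc m)
      have "fps_nth ((1 + fps_X) * fps_deriv B) n =
          of_nat (Suc n) * fps_nth B (Suc n) + of_nat n * fps_nth B n"
        using Suc by (simp add: distrib_right del: of_nat_Suc)
      also have "\<dots> = a * fps_nth B n"
        unfolding rec by (simp add: left_diff_distrib)
      finally show ?thesis by simp
    qed
  qed
  have "f * fps_compose (fps_deriv B) (f - 1) = fps_compose ((1 + fps_X) * fps_deriv B) (f - 1)"
    by (simp add: fps_compose_mult_distrib[OF f0] fps_compose_add_distrib f0 assms)
  also have "\<dots> = fps_const a * fps_gpow f a"
    unfolding ode gpow by (simp add: fps_compose_mult_distrib[OF f0])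
  finally have B': "f * fps_compose (fps_deriv B) (f - 1) = fps_const a * fps_gpow f a" .
  have "f * fps_deriv (fps_gpow f a) = (f * fps_compose (fps_deriv B) (f - 1)) * fps_deriv f"
    unfolding gpow fps_compose_deriv[OF f0] by (simp add: mult.assoc)
  also have "\<dots> = fps_const a * fps_deriv f * fps_gpow f a"
    unfolding B' by (simp only: mult_ac)
  finally show ?thesis .
qed

theorem theorem7p1:
  "tree_egf = fps_gpow ((1 - fps_X) * (1 - fps_const xvar * fps_X)) (- yvar)"
proof (rule fps_linear_ode_unique)
  define f where "f = (1 - fps_X) * (1 - fps_const xvar * fps_X)"
  have f0: "fps_nth f 0 = 1" by (simp add: f_def)
  have f': "fps_deriv f = - (1 - fps_const xvar * fps_X) - fps_const xvar * (1 - fps_X)"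
    by (simp add: f_def algebra_simps)
  show "fps_nth ((1 - fps_X) * (1 - fps_const xvar * fps_X)) 0 = 1"
    using f0 by (simp only: f_def)
  show "(1 - fps_X) * (1 - fps_const xvar * fps_X)
      * fps_deriv (fps_gpow ((1 - fps_X) * (1 - fps_const xvar * fps_X)) (- yvar))
    = fps_const (- yvar) * fps_deriv ((1 - fps_X) * (1 - fps_const xvar * fps_X))
      * fps_gpow ((1 - fps_X) * (1 - fps_const xvar * fps_X)) (- yvar)"
    using fps_deriv_gpow[OF f0] by (simp only: f_def)
  let ?U = "rising_series 1" and ?V = "rising_series xvar"
  have U: "(1 - fps_X) * fps_deriv ?U = fps_const yvar * ?U"
    using fps_deriv_rising_series[of 1] by simp
  have V: "(1 - fps_const xvar * fps_X) * fps_deriv ?V = fps_const xvar * (fps_const yvar * ?V)"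
    using fps_deriv_rising_series[of xvar] by (simp add: mult_ac flip: fps_const_mult)
  \<comment> \<open>The product rule combines the equations of the two factors, since \<open>f\<close> is the product of their
      coefficients \<open>1 - z\<close> and \<open>1 - xz\<close>.\<close>
  have "f * fps_deriv tree_egf
      = (1 - fps_const xvar * fps_X) * ?V * ((1 - fps_X) * fps_deriv ?U)
        + (1 - fps_X) * ?U * ((1 - fps_const xvar * fps_X) * fps_deriv ?V)"
    unfolding tree_egf_eq_prod f_def fps_deriv_mult by (simp only: algebra_simps)
  also have "\<dots> = fps_const (- yvar) * fps_deriv f * tree_egf"
    unfolding U V tree_egf_eq_prod f' fps_const_neg[symmetric]
    by (simp only: algebra_simps mult_minus_left mult_minus_right minus_diff_eq mult_1_left mult_1_right) simp
  finally show "(1 - fps_X) * (1 - fps_const xvar * fps_X) * fps_deriv tree_egf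
    = fps_const (- yvar) * fps_deriv ((1 - fps_X) * (1 - fps_const xvar * fps_X)) * tree_egf"
    by (simp only: f_def)
  show "fps_nth tree_egf 0
      = fps_nth (fps_gpow ((1 - fps_X) * (1 - fps_const xvar * fps_X)) (- yvar)) 0"
    by (simp add: tree_egf_eq_prod rising_series_def fps_gpow_def one_pCons)
qed

end
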